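(* (1) For a strict monoidal category $\mathcal C$, the category $\mathbf{UAlg}(\mathcal C)$ can be seen as a full subcategory of $\mathbf{Br}^{\nu}(\mathcal C)$ via the functor $$(V,\mu,\nu)\mapsto(V,\sigma_{Ass}=\nu\otimes\mu,\nu),\qquad (f:V\to W)\mapsto(f:V\to W).$$ (2) For a symmetric preadditive strict monoidal category $(\mathcal C,\otimes,\mathbf I,c)$, the category $\mathbf{ULei}^*(\mathcal C)$ can be seen as a full subcategory of $\mathbf{Br}^{\nu}(\mathcal C)$ via the functor $$(V,[,],\nu)\mapsto(V,\sigma_{Lei}=c_{V,V}+\nu\otimes[,],\nu),\qquad (f:V\to W)\mapsto(f:V\to W).$$
   Context: In a preadditive monoidal category, $\otimes$ is additive in each variable; $\mathbf I$ is the unit object and $c$ the symmetric braiding. $\mathbf{UAlg}(\mathcal C)$: objects are triples $(V,\mu,\nu)$ with $\mu:V\otimes V\to V$ associative and $\nu:\mathbf I\to V$ a two-sided unit for $\mu$; morphisms are morphisms $f:V\to W$ of $\mathcal C$ with $f\mu_V=\mu_W(f\otimes f)$ and $f\nu_V=\nu_W$. A unital Leibniz algebra in $\mathcal C$ is $(V,[,],\nu)$ with $[,]:V\otimes V\to V$, $\nu:\mathbf I\to V$ such that $[,]\circ(\mathrm{Id}_V\otimes[,])=[,]\circ([,]\otimes\mathrm{Id}_V)-[,]\circ([,]\otimes\mathrm{Id}_V)\circ(\mathrm{Id}_V\otimes c_{V,V})$ and $[,]\circ(\mathrm{Id}_V\otimes\nu)=[,]\circ(\nu\otimes\mathrm{Id}_V)=0$.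 $\mathbf{ULei}^*(\mathcal C)$ is the category of unital Leibniz algebras $V$ in $\mathcal C$ possessing a normalized morphism $\gamma:V\to\mathbf I$ (i.e. a morphism of $\mathcal C$ with $\gamma\circ\nu=\mathrm{Id}_{\mathbf I}$), with morphisms those $f:V\to W$ of $\mathcal C$ such that $f\circ[,]_V=[,]_W\circ(f\otimes f)$ and $f\nu_V=\nu_W$. $\mathbf{Br}^{\nu}(\mathcal C)$: objects are triples $(V,\sigma,\nu)$ with $\sigma:V\otimes V\to V\otimes V$ a pre-braiding, i.e. $(\sigma\otimes\mathrm{Id})(\mathrm{Id}\otimes\sigma)(\sigma\otimes\mathrm{Id})=(\mathrm{Id}\otimes\sigma)(\sigma\otimes\mathrm{Id})(\mathrm{Id}\otimes\sigma)$ on $V^{\otimes 3}$, and $\nu:\mathbf I\to V$ any morphism; morphisms are morphisms $f:V\to W$ of $\mathcal C$ with $(f\otimes f)\sigma_V=\sigma_W(f\otimes f)$ and $f\nu_V=\nu_W$. "Can be seen as a full subcategory via the functor" means that the functor is well defined, injective on objects, and fully faithful. *)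

theory Defs
  imports "HOL-Algebra.Group"
begin

section \<open>Categories and functors\<close>

text \<open>
  A category has a set of objects and a set of arrows, each arrow having a unique domain and
  codomain. The operations are only constrained on these sets.
  Composition is written in applicative order: \<open>g \<cdot> f\<close> is ``first \<open>f\<close>, then \<open>g\<close>''.
\<close>

record ('o, 'm) category =
  Obj :: "'o set"
  Arr :: "'m set"
  Dom :: "'m \<Rightarrow> 'o"
  Cod :: "'m \<Rightarrow> 'o"
  Ident :: "'o \<Rightarrow> 'm"
  Comp :: "'m \<Rightarrow> 'm \<Rightarrow> 'm" (infixr "\<cdot>\<index>" 65)

definition Hom :: "('o, 'm, 'z) category_scheme \<Rightarrow> 'o \<Rightarrow> 'o \<Rightarrow> 'm set" where
  "Hom C A B = {f \<in> Arr C. Dom C f = A \<and> Cod C f = B}"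

locale category =
  fixes C :: "('o, 'm, 'z) category_scheme" (structure)
  assumes Dom_closed: "f \<in> Arr C \<Longrightarrow> Dom C f \<in> Obj C"
    and Cod_closed: "f \<in> Arr C \<Longrightarrow> Cod C f \<in> Obj C"
    and Ident_in_Hom: "A \<in> Obj C \<Longrightarrow> Ident C A \<in> Hom C A A"
    and Comp_in_Hom: "\<lbrakk>f \<in> Hom C X Y; g \<in> Hom C Y Z\<rbrakk> \<Longrightarrow> g \<cdot> f \<in> Hom C X Z"
    and Comp_Ident_left: "f \<in> Hom C X Y \<Longrightarrow> Ident C Y \<cdot> f = f"
    and Comp_Ident_right: "f \<in> Hom C X Y \<Longrightarrow> f \<cdot> Ident C X = f"
    and Comp_assoc: "\<lbrakk>f \<in> Hom C W X; g \<in> Hom C X Y; h \<in> Hom C Y Z\<rbrakk>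
      \<Longrightarrow> (h \<cdot> g) \<cdot> f = h \<cdot> (g \<cdot> f)"

locale covariant_functor =
  source: category A + target: category B
  for A :: "('o1, 'm1, 'z1) category_scheme" and B :: "('o2, 'm2, 'z2) category_scheme" +
  fixes Fo :: "'o1 \<Rightarrow> 'o2" and Fa :: "'m1 \<Rightarrow> 'm2"
  assumes map_Obj: "X \<in> Obj A \<Longrightarrow> Fo X \<in> Obj B"
    and map_Hom: "f \<in> Hom A X Y \<Longrightarrow> Fa f \<in> Hom B (Fo X) (Fo Y)"
    and map_Ident: "X \<in> Obj A \<Longrightarrow> Fa (Ident A X) = Ident B (Fo X)"
    and map_Comp: "\<lbrakk>f \<in> Hom A X Y; g \<in> Hom A Y Z\<rbrakk>
      \<Longrightarrow> Fa (g \<cdot>\<^bsub>A\<^esub> f) = Fa g \<cdot>\<^bsub>B\<^esub> Fa f"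

definition fully_faithful ::
  "('o1, 'm1, 'z1) category_scheme \<Rightarrow> ('o2, 'm2, 'z2) category_scheme
    \<Rightarrow> ('o1 \<Rightarrow> 'o2) \<Rightarrow> ('m1 \<Rightarrow> 'm2) \<Rightarrow> bool" where
  "fully_faithful A B Fo Fa \<longleftrightarrow>
    (\<forall>X \<in> Obj A. \<forall>Y \<in> Obj A. bij_betw Fa (Hom A X Y) (Hom B (Fo X) (Fo Y)))"

definition full_subcategory_via ::
  "('o1, 'm1, 'z1) category_scheme \<Rightarrow> ('o2, 'm2, 'z2) category_scheme
    \<Rightarrow> ('o1 \<Rightarrow> 'o2) \<Rightarrow> ('m1 \<Rightarrow> 'm2) \<Rightarrow> bool" where
  "full_subcategory_via A B Fo Fa \<longleftrightarrow>
    covariant_functor A B Fo Fa \<and> inj_on Fo (Obj A) \<and> fully_faithful A B Fo Fa"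


section \<open>Strict monoidal categories\<close>

record ('o, 'm) monoidal = "('o, 'm) category" +
  tensor_obj :: "'o \<Rightarrow> 'o \<Rightarrow> 'o" (infixr "\<odot>\<index>" 75)
  tensor_arr :: "'m \<Rightarrow> 'm \<Rightarrow> 'm" (infixr "\<boxtimes>\<index>" 75)
  unit_obj :: "'o"

locale strict_monoidal_category = category C
  for C :: "('o, 'm, 'z) monoidal_scheme" (structure) +
  assumes unit_closed: "unit_obj C \<in> Obj C"
    and tensor_obj_closed: "\<lbrakk>X \<in> Obj C; Y \<in> Obj C\<rbrakk> \<Longrightarrow> X \<odot> Y \<in> Obj C"
    and tensor_in_Hom: "\<lbrakk>f \<in> Hom C X Y; g \<in> Hom C X' Y'\<rbrakk>
      \<Longrightarrow> f \<boxtimes> g \<in> Hom C (X \<odot> X') (Y \<odot> Y')"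
    and tensor_Ident: "\<lbrakk>X \<in> Obj C; Y \<in> Obj C\<rbrakk>
      \<Longrightarrow> Ident C X \<boxtimes> Ident C Y = Ident C (X \<odot> Y)"
    and interchange: "\<lbrakk>f \<in> Hom C X Y; g \<in> Hom C Y Z; f' \<in> Hom C X' Y'; g' \<in> Hom C Y' Z'\<rbrakk>
      \<Longrightarrow> (g \<cdot> f) \<boxtimes> (g' \<cdot> f') = (g \<boxtimes> g') \<cdot> (f \<boxtimes> f')"
    and tensor_obj_assoc: "\<lbrakk>X \<in> Obj C; Y \<in> Obj C; Z \<in> Obj C\<rbrakk>
      \<Longrightarrow> (X \<odot> Y) \<odot> Z = X \<odot> (Y \<odot> Z)"
    and tensor_arr_assoc: "\<lbrakk>f \<in> Arr C; g \<in> Arr C; h \<in> Arr C\<rbrakk>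
      \<Longrightarrow> (f \<boxtimes> g) \<boxtimes> h = f \<boxtimes> (g \<boxtimes> h)"
    and unit_obj_left: "X \<in> Obj C \<Longrightarrow> unit_obj C \<odot> X = X"
    and unit_obj_right: "X \<in> Obj C \<Longrightarrow> X \<odot> unit_obj C = X"
    and unit_arr_left: "f \<in> Arr C \<Longrightarrow> Ident C (unit_obj C) \<boxtimes> f = f"
    and unit_arr_right: "f \<in> Arr C \<Longrightarrow> f \<boxtimes> Ident C (unit_obj C) = f"

record ('o, 'm) symmetric_monoidal = "('o, 'm) monoidal" +
  braid :: "'o \<Rightarrow> 'o \<Rightarrow> 'm"

locale symmetric_strict_monoidal_category = strict_monoidal_category C
  for C :: "('o, 'm, 'z) symmetric_monoidal_scheme" (structure) +
  assumes braid_in_Hom: "\<lbrakk>X \<in> Obj C; Y \<in> Obj C\<rbrakk> \<Longrightarrow> braid C X Y \<in> Hom C (X \<odot> Y) (Y \<odot> X)"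
    and braid_natural: "\<lbrakk>f \<in> Hom C X Y; g \<in> Hom C X' Y'\<rbrakk>
      \<Longrightarrow> braid C Y Y' \<cdot> (f \<boxtimes> g) = (g \<boxtimes> f) \<cdot> braid C X X'"
    and hexagon_left: "\<lbrakk>X \<in> Obj C; Y \<in> Obj C; Z \<in> Obj C\<rbrakk>
      \<Longrightarrow> braid C X (Y \<odot> Z) = (Ident C Y \<boxtimes> braid C X Z) \<cdot> (braid C X Y \<boxtimes> Ident C Z)"
    and hexagon_right: "\<lbrakk>X \<in> Obj C; Y \<in> Obj C; Z \<in> Obj C\<rbrakk>
      \<Longrightarrow> braid C (X \<odot> Y) Z = (braid C X Z \<boxtimes> Ident C Y) \<cdot> (Ident C X \<boxtimes> braid C Y Z)"
    and braid_symmetric: "\<lbrakk>X \<in> Obj C; Y \<in> Obj C\<rbrakk>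
      \<Longrightarrow> braid C Y X \<cdot> braid C X Y = Ident C (X \<odot> Y)"

record ('o, 'm) preadditive_symmetric_monoidal = "('o, 'm) symmetric_monoidal" +
  hom_add :: "'m \<Rightarrow> 'm \<Rightarrow> 'm" (infixl "\<boxplus>\<index>" 60)
  hom_zero :: "'o \<Rightarrow> 'o \<Rightarrow> 'm"

definition hom_group ::
  "('o, 'm, 'z) preadditive_symmetric_monoidal_scheme \<Rightarrow> 'o \<Rightarrow> 'o \<Rightarrow> 'm monoid" where
  "hom_group C X Y = \<lparr>carrier = Hom C X Y, mult = hom_add C, one = hom_zero C X Y\<rparr>"

definition hom_diff ::
  "('o, 'm, 'z) preadditive_symmetric_monoidal_scheme \<Rightarrow> 'o \<Rightarrow> 'o \<Rightarrow> 'm \<Rightarrow> 'm \<Rightarrow> 'm" where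
  "hom_diff C X Y f g = f \<boxplus>\<^bsub>C\<^esub> (inv\<^bsub>hom_group C X Y\<^esub> g)"

locale symmetric_preadditive_strict_monoidal_category = symmetric_strict_monoidal_category C
  for C :: "('o, 'm, 'z) preadditive_symmetric_monoidal_scheme" (structure) +
  assumes hom_comm_group: "\<lbrakk>X \<in> Obj C; Y \<in> Obj C\<rbrakk> \<Longrightarrow> comm_group (hom_group C X Y)"
    and Comp_add_left: "\<lbrakk>f \<in> Hom C X Y; g \<in> Hom C Y Z; h \<in> Hom C Y Z\<rbrakk>
      \<Longrightarrow> (g \<boxplus> h) \<cdot> f = (g \<cdot> f) \<boxplus> (h \<cdot> f)"
    and Comp_add_right: "\<lbrakk>f \<in> Hom C X Y; g \<in> Hom C X Y; h \<in> Hom C Y Z\<rbrakk>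
      \<Longrightarrow> h \<cdot> (f \<boxplus> g) = (h \<cdot> f) \<boxplus> (h \<cdot> g)"
    and tensor_add_left: "\<lbrakk>f \<in> Hom C X Y; g \<in> Hom C X Y; h \<in> Hom C X' Y'\<rbrakk>
      \<Longrightarrow> (f \<boxplus> g) \<boxtimes> h = (f \<boxtimes> h) \<boxplus> (g \<boxtimes> h)"
    and tensor_add_right: "\<lbrakk>f \<in> Hom C X Y; g \<in> Hom C X' Y'; h \<in> Hom C X' Y'\<rbrakk>
      \<Longrightarrow> f \<boxtimes> (g \<boxplus> h) = (f \<boxtimes> g) \<boxplus> (f \<boxtimes> h)"


section \<open>Categories of structured objects\<close>

text \<open>
  Objects are triples consisting of an object of \<open>C\<close> and two arrows of \<open>C\<close>. One and the same
  arrow of \<open>C\<close> may be a morphism between several structured objects, so the arrows of the new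
  category are arrows of \<open>C\<close> tagged with their structured source and target.
\<close>

type_synonym ('o, 'm) structured = "'o \<times> 'm \<times> 'm"

type_synonym ('o, 'm) structured_arr = "('o, 'm) structured \<times> 'm \<times> ('o, 'm) structured"

definition structured_category ::
  "('o, 'm, 'z) category_scheme \<Rightarrow> ('o, 'm) structured set
    \<Rightarrow> (('o, 'm) structured \<Rightarrow> ('o, 'm) structured \<Rightarrow> 'm \<Rightarrow> bool)
    \<Rightarrow> (('o, 'm) structured, ('o, 'm) structured_arr) category" where
  "structured_category C S is_mor = \<lparr>
    Obj = S,
    Arr = {(A, f, B). A \<in> S \<and> B \<in> S \<and> f \<in> Hom C (fst A) (fst B) \<and> is_mor A B f},
    Dom = (\<lambda>(A, f, B). A),
    Cod = (\<lambda>(A, f, B). B),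
    Ident = (\<lambda>A. (A, Ident C (fst A), A)),
    Comp = (\<lambda>(B, g, D) (A, f, B'). (A, g \<cdot>\<^bsub>C\<^esub> f, D))\<rparr>"

text \<open>The action \<open>(f : V \<rightarrow> W) \<mapsto> (f : V \<rightarrow> W)\<close> on arrows, where only the tags change.\<close>

definition same_arrow ::
  "(('o, 'm) structured \<Rightarrow> ('o, 'm) structured)
    \<Rightarrow> ('o, 'm) structured_arr \<Rightarrow> ('o, 'm) structured_arr" where
  "same_arrow Fo = (\<lambda>(A, f, B). (Fo A, f, Fo B))"


definition unital_assoc_algebra ::
  "('o, 'm, 'z) monoidal_scheme \<Rightarrow> 'o \<Rightarrow> 'm \<Rightarrow> 'm \<Rightarrow> bool" where
  "unital_assoc_algebra C V \<mu> \<nu> \<longleftrightarrow>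
    V \<in> Obj C \<and> \<mu> \<in> Hom C (V \<odot>\<^bsub>C\<^esub> V) V \<and> \<nu> \<in> Hom C (unit_obj C) V \<and>
    \<mu> \<cdot>\<^bsub>C\<^esub> (\<mu> \<boxtimes>\<^bsub>C\<^esub> Ident C V) = \<mu> \<cdot>\<^bsub>C\<^esub> (Ident C V \<boxtimes>\<^bsub>C\<^esub> \<mu>) \<and>
    \<mu> \<cdot>\<^bsub>C\<^esub> (\<nu> \<boxtimes>\<^bsub>C\<^esub> Ident C V) = Ident C V \<and>
    \<mu> \<cdot>\<^bsub>C\<^esub> (Ident C V \<boxtimes>\<^bsub>C\<^esub> \<nu>) = Ident C V"

text \<open>Morphism condition shared by unital associative and unital Leibniz algebras.\<close>

fun pointed_algebra_morphism ::
  "('o, 'm, 'z) monoidal_scheme \<Rightarrow> ('o, 'm) structured \<Rightarrow> ('o, 'm) structured \<Rightarrow> 'm \<Rightarrow> bool" where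
  "pointed_algebra_morphism C (V, \<mu>, \<nu>) (W, \<mu>', \<nu>') f \<longleftrightarrow>
    f \<cdot>\<^bsub>C\<^esub> \<mu> = \<mu>' \<cdot>\<^bsub>C\<^esub> (f \<boxtimes>\<^bsub>C\<^esub> f) \<and> f \<cdot>\<^bsub>C\<^esub> \<nu> = \<nu>'"

definition UAlg ::
  "('o, 'm, 'z) monoidal_scheme \<Rightarrow> (('o, 'm) structured, ('o, 'm) structured_arr) category" where
  "UAlg C = structured_category C {(V, \<mu>, \<nu>). unital_assoc_algebra C V \<mu> \<nu>}
    (pointed_algebra_morphism C)"


definition unital_leibniz_algebra ::
  "('o, 'm, 'z) preadditive_symmetric_monoidal_scheme \<Rightarrow> 'o \<Rightarrow> 'm \<Rightarrow> 'm \<Rightarrow> bool" where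
  "unital_leibniz_algebra C V br \<nu> \<longleftrightarrow>
    V \<in> Obj C \<and> br \<in> Hom C (V \<odot>\<^bsub>C\<^esub> V) V \<and> \<nu> \<in> Hom C (unit_obj C) V \<and>
    br \<cdot>\<^bsub>C\<^esub> (Ident C V \<boxtimes>\<^bsub>C\<^esub> br) =
      hom_diff C (V \<odot>\<^bsub>C\<^esub> V \<odot>\<^bsub>C\<^esub> V) V
        (br \<cdot>\<^bsub>C\<^esub> (br \<boxtimes>\<^bsub>C\<^esub> Ident C V))
        (br \<cdot>\<^bsub>C\<^esub> (br \<boxtimes>\<^bsub>C\<^esub> Ident C V) \<cdot>\<^bsub>C\<^esub> (Ident C V \<boxtimes>\<^bsub>C\<^esub> braid C V V)) \<and>
    br \<cdot>\<^bsub>C\<^esub> (Ident C V \<boxtimes>\<^bsub>C\<^esub> \<nu>) = hom_zero C V V \<and>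
    br \<cdot>\<^bsub>C\<^esub> (\<nu> \<boxtimes>\<^bsub>C\<^esub> Ident C V) = hom_zero C V V"

definition has_normalized_morphism ::
  "('o, 'm, 'z) monoidal_scheme \<Rightarrow> 'o \<Rightarrow> 'm \<Rightarrow> bool" where
  "has_normalized_morphism C V \<nu> \<longleftrightarrow>
    (\<exists>\<gamma> \<in> Hom C V (unit_obj C). \<gamma> \<cdot>\<^bsub>C\<^esub> \<nu> = Ident C (unit_obj C))"

definition ULei_star ::
  "('o, 'm, 'z) preadditive_symmetric_monoidal_scheme
    \<Rightarrow> (('o, 'm) structured, ('o, 'm) structured_arr) category" where
  "ULei_star C = structured_category C
    {(V, br, \<nu>). unital_leibniz_algebra C V br \<nu> \<and> has_normalized_morphism C V \<nu>}
    (pointed_algebra_morphism C)"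


text \<open>A pre-braiding need not be invertible.\<close>

definition pre_braiding :: "('o, 'm, 'z) monoidal_scheme \<Rightarrow> 'o \<Rightarrow> 'm \<Rightarrow> bool" where
  "pre_braiding C V \<sigma> \<longleftrightarrow>
    \<sigma> \<in> Hom C (V \<odot>\<^bsub>C\<^esub> V) (V \<odot>\<^bsub>C\<^esub> V) \<and>
    (\<sigma> \<boxtimes>\<^bsub>C\<^esub> Ident C V) \<cdot>\<^bsub>C\<^esub> (Ident C V \<boxtimes>\<^bsub>C\<^esub> \<sigma>) \<cdot>\<^bsub>C\<^esub> (\<sigma> \<boxtimes>\<^bsub>C\<^esub> Ident C V) =
    (Ident C V \<boxtimes>\<^bsub>C\<^esub> \<sigma>) \<cdot>\<^bsub>C\<^esub> (\<sigma> \<boxtimes>\<^bsub>C\<^esub> Ident C V) \<cdot>\<^bsub>C\<^esub> (Ident C V \<boxtimes>\<^bsub>C\<^esub> \<sigma>)"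

fun pointed_braided_morphism ::
  "('o, 'm, 'z) monoidal_scheme \<Rightarrow> ('o, 'm) structured \<Rightarrow> ('o, 'm) structured \<Rightarrow> 'm \<Rightarrow> bool" where
  "pointed_braided_morphism C (V, \<sigma>, \<nu>) (W, \<sigma>', \<nu>') f \<longleftrightarrow>
    (f \<boxtimes>\<^bsub>C\<^esub> f) \<cdot>\<^bsub>C\<^esub> \<sigma> = \<sigma>' \<cdot>\<^bsub>C\<^esub> (f \<boxtimes>\<^bsub>C\<^esub> f) \<and> f \<cdot>\<^bsub>C\<^esub> \<nu> = \<nu>'"

definition Br_nu ::
  "('o, 'm, 'z) monoidal_scheme \<Rightarrow> (('o, 'm) structured, ('o, 'm) structured_arr) category" where
  "Br_nu C = structured_category C
    {(V, \<sigma>, \<nu>). V \<in> Obj C \<and> pre_braiding C V \<sigma> \<and> \<nu> \<in> Hom C (unit_obj C) V}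
    (pointed_braided_morphism C)"


text \<open>
  By strictness the domain of \<open>\<nu> \<boxtimes> \<mu>\<close> (and of \<open>\<nu> \<boxtimes> br\<close>) is \<open>unit_obj C \<odot> (V \<odot> V) = V \<odot> V\<close>.
\<close>

fun sigma_Ass_obj ::
  "('o, 'm, 'z) monoidal_scheme \<Rightarrow> ('o, 'm) structured \<Rightarrow> ('o, 'm) structured" where
  "sigma_Ass_obj C (V, \<mu>, \<nu>) = (V, \<nu> \<boxtimes>\<^bsub>C\<^esub> \<mu>, \<nu>)"

fun sigma_Lei_obj ::
  "('o, 'm, 'z) preadditive_symmetric_monoidal_scheme
    \<Rightarrow> ('o, 'm) structured \<Rightarrow> ('o, 'm) structured" where
  "sigma_Lei_obj C (V, br, \<nu>) = (V, braid C V V \<boxplus>\<^bsub>C\<^esub> (\<nu> \<boxtimes>\<^bsub>C\<^esub> br), \<nu>)"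

end

theory Submission
  imports Defs
begin

text \<open>
  Both functors leave the underlying arrow and the unit \<open>\<nu>\<close> untouched and replace the
  multiplication \<open>m : V \<otimes> V \<rightarrow> V\<close> by a pre-braiding in which \<open>m\<close> occurs only through
  \<open>\<nu> \<otimes> m\<close>. Three things make this a full embedding.

  \<^item> A functor that only retags arrows is fully faithful as soon as the two morphism predicates
    agree on the arrows of the base category (\<open>full_subcategory_via_structured\<close>), so everything
    is about equations in \<open>C\<close>.

  \<^item> \<open>m\<close> can be recovered from \<open>\<nu> \<otimes> m\<close>, because \<open>\<nu> \<otimes> Id\<close> is a split monomorphism
    (\<open>point_tensor_cancel\<close>). For associative algebras the retraction is the multiplication
    itself, by the unit law; for Leibniz algebras the bracket kills \<open>\<nu>\<close>, and it is the
    normalized morphism \<open>\<gamma>\<close> that supplies the retraction \<open>\<gamma> \<otimes> Id\<close>. This yields injectivity on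
    objects. It also shows that \<open>f\<close> intertwines the pre-braidings iff it intertwines the
    multiplications: if \<open>f \<nu> = \<nu>'\<close>, both sides of the braided condition are \<open>\<nu>' \<otimes> _\<close> of the two
    sides of the algebra condition (\<open>tensor_square_intertwines_point\<close>). In the Leibniz case both
    carry in addition the same summand, by naturality of \<open>c\<close>.

  \<^item> The Yang--Baxter equation encodes the axioms. With elements, writing \<open>1\<close> for \<open>\<nu>\<close>,
    \<open>\<sigma>(a, b) = (1, ab)\<close> turns \<open>(a, b, c)\<close> into \<open>(1, 1, (ab)c)\<close> on one side and into
    \<open>(1, 1, a(bc))\<close> on the other. For \<open>\<sigma>(a, b) = (b, a) + (1, [a, b])\<close>
    each side expands into eight terms. Those with no or one bracket match through naturality and
    symmetry of \<open>c\<close>, those that bracket with \<open>1\<close> vanish since \<open>[1, _] = [_, 1] = 0\<close>, and the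
    remaining ones are \<open>(1, 1, [[a, b], c])\<close> on the left, and
    \<open>(1, 1, [[a, c], b]) + (1, 1, [a, [b, c]])\<close> on the right: this is the Leibniz identity.
\<close>

section \<open>Full embeddings between categories of structured objects\<close>

lemma structured_category_simps:
  "Obj (structured_category C S P) = S"
  "Arr (structured_category C S P) =
    {(A, f, B). A \<in> S \<and> B \<in> S \<and> f \<in> Hom C (fst A) (fst B) \<and> P A B f}"
  "Dom (structured_category C S P) (A, f, B) = A"
  "Cod (structured_category C S P) (A, f, B) = B"
  "Ident (structured_category C S P) A = (A, Ident C (fst A), A)"
  "(B, g, D) \<cdot>\<^bsub>structured_category C S P\<^esub> (A, f, B') = (A, g \<cdot>\<^bsub>C\<^esub> f, D)"
  by (simp_all add: structured_category_def)

lemma Hom_structured_category: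
  "t \<in> Hom (structured_category C S P) A B \<longleftrightarrow>
    A \<in> S \<and> B \<in> S \<and> (\<exists>f \<in> Hom C (fst A) (fst B). P A B f \<and> t = (A, f, B))"
  by (cases t)
    (auto simp: Hom_def[of "structured_category C S P"] structured_category_simps)

lemma category_structured_category:
  assumes "category C"
    and objects: "\<And>A. A \<in> S \<Longrightarrow> fst A \<in> Obj C"
    and identities: "\<And>A. A \<in> S \<Longrightarrow> P A A (Ident C (fst A))"
    and composites: "\<And>A B D f g. \<lbrakk>A \<in> S; B \<in> S; D \<in> S; f \<in> Hom C (fst A) (fst B);
      g \<in> Hom C (fst B) (fst D); P A B f; P B D g\<rbrakk> \<Longrightarrow> P A D (g \<cdot>\<^bsub>C\<^esub> f)"
  shows "category (structured_category C S P)"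
proof -
  interpret category C by fact
  show ?thesis
  proof
    fix A assume "A \<in> Obj (structured_category C S P)"
    then show "Ident (structured_category C S P) A \<in> Hom (structured_category C S P) A A"
      by (simp add: Hom_structured_category structured_category_simps objects identities
          Ident_in_Hom)
  next
    fix s t A B D
    assume "s \<in> Hom (structured_category C S P) A B" "t \<in> Hom (structured_category C S P) B D"
    then show "t \<cdot>\<^bsub>structured_category C S P\<^esub> s \<in> Hom (structured_category C S P) A D"
      by (auto simp: Hom_structured_category structured_category_simps
          intro: composites Comp_in_Hom)
  qed (auto simp: Hom_structured_category structured_category_simps Comp_Ident_left
      Comp_Ident_right Comp_assoc)
qed

text \<open>
  Arrows between tagged objects are untagged arrows satisfying a predicate, so a functor keeping
  the untagged arrow is faithful for free, and well defined and full by the two directions of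
  \<open>hom_iff\<close>.
\<close>

lemma full_subcategory_via_structured:
  assumes "category (structured_category C S P)" "category (structured_category C T Q)"
    and maps: "\<And>A. A \<in> S \<Longrightarrow> Fo A \<in> T"
    and carrier: "\<And>A. A \<in> S \<Longrightarrow> fst (Fo A) = fst A"
    and inj: "inj_on Fo S"
    and hom_iff: "\<And>A B f. \<lbrakk>A \<in> S; B \<in> S; f \<in> Hom C (fst A) (fst B)\<rbrakk>
      \<Longrightarrow> P A B f \<longleftrightarrow> Q (Fo A) (Fo B) f"
  shows "full_subcategory_via (structured_category C S P) (structured_category C T Q)
    Fo (same_arrow Fo)"
proof -
  have "covariant_functor (structured_category C S P) (structured_category C T Q)
    Fo (same_arrow Fo)"
    by (intro covariant_functor.intro covariant_functor_axioms.intro assms(1,2))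
      (auto simp: structured_category_simps Hom_structured_category maps carrier
        hom_iff[symmetric] same_arrow_def)
  moreover have "fully_faithful (structured_category C S P) (structured_category C T Q)
    Fo (same_arrow Fo)"
    unfolding fully_faithful_def structured_category_simps
  proof (intro ballI bij_betw_imageI)
    fix A B assume A: "A \<in> S" "B \<in> S"
    show "inj_on (same_arrow Fo) (Hom (structured_category C S P) A B)"
      by (auto simp: inj_on_def Hom_structured_category same_arrow_def)
    show "same_arrow Fo ` Hom (structured_category C S P) A B =
        Hom (structured_category C T Q) (Fo A) (Fo B)"
    proof (intro equalityI subsetI)
      fix t assume "t \<in> Hom (structured_category C T Q) (Fo A) (Fo B)"
      then obtain f where "f \<in> Hom C (fst A) (fst B)" "P A B f" "t = same_arrow Fo (A, f, B)"
        using A by (auto simp: Hom_structured_category carrier hom_iff same_arrow_def)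
      with A show "t \<in> same_arrow Fo ` Hom (structured_category C S P) A B"
        by (intro image_eqI[of _ _ "(A, f, B)"]) (auto simp: Hom_structured_category)
    qed (use A in \<open>auto simp: Hom_structured_category maps carrier hom_iff same_arrow_def\<close>)
  qed
  ultimately show ?thesis
    using inj by (simp add: full_subcategory_via_def structured_category_simps)
qed

section \<open>Arrow calculus in a strict monoidal category\<close>

text \<open>
  The axioms mention the source and target of an arrow only through \<open>Hom\<close>, so using them as rewrite
  rules would mean guessing objects. Restated with \<open>Dom\<close> and \<open>Cod\<close>, typing becomes
  a matter of simplification.
\<close>

context category
begin

lemma Hom_iff: "f \<in> Hom C X Y \<longleftrightarrow> f \<in> Arr C \<and> Dom C f = X \<and> Cod C f = Y"
  by (auto simp: Hom_def)

lemma Ident_typing [simp]: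
  assumes "X \<in> Obj C"
  shows "Ident C X \<in> Arr C" "Dom C (Ident C X) = X" "Cod C (Ident C X) = X"
  using Ident_in_Hom[OF assms] by (auto simp: Hom_iff)

lemma Comp_typing [simp]:
  assumes "f \<in> Arr C" "g \<in> Arr C" "Dom C g = Cod C f"
  shows "g \<cdot> f \<in> Arr C" "Dom C (g \<cdot> f) = Dom C f" "Cod C (g \<cdot> f) = Cod C g"
  using Comp_in_Hom[of f "Dom C f" "Cod C f" g "Cod C g"] assms by (auto simp: Hom_iff)

lemma Comp_Ident [simp]:
  "\<lbrakk>f \<in> Arr C; Cod C f = Y\<rbrakk> \<Longrightarrow> Ident C Y \<cdot> f = f"
  "\<lbrakk>f \<in> Arr C; Dom C f = X\<rbrakk> \<Longrightarrow> f \<cdot> Ident C X = f"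
  using Comp_Ident_left[of f "Dom C f" Y] Comp_Ident_right[of f X "Cod C f"]
  by (auto simp: Hom_iff)

lemma Comp_assoc_Arr:
  "\<lbrakk>f \<in> Arr C; g \<in> Arr C; h \<in> Arr C; Dom C g = Cod C f; Dom C h = Cod C g\<rbrakk>
    \<Longrightarrow> (h \<cdot> g) \<cdot> f = h \<cdot> (g \<cdot> f)"
  using Comp_assoc[of f "Dom C f" "Cod C f" g "Cod C g" h "Cod C h"] by (auto simp: Hom_iff)

end

context strict_monoidal_category
begin

lemmas object_simps [simp] =
  unit_closed tensor_obj_closed tensor_obj_assoc unit_obj_left unit_obj_right
  Dom_closed Cod_closed

lemma tensor_typing [simp]:
  assumes "f \<in> Arr C" "g \<in> Arr C"
  shows "f \<boxtimes> g \<in> Arr C" "Dom C (f \<boxtimes> g) = Dom C f \<odot> Dom C g"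
    "Cod C (f \<boxtimes> g) = Cod C f \<odot> Cod C g"
  using tensor_in_Hom[of f "Dom C f" "Cod C f" g "Dom C g" "Cod C g"] assms
  by (auto simp: Hom_iff)

lemma Comp_tensor:
  "\<lbrakk>f \<in> Arr C; g \<in> Arr C; f' \<in> Arr C; g' \<in> Arr C; Dom C g = Cod C f; Dom C g' = Cod C f'\<rbrakk>
    \<Longrightarrow> (g \<boxtimes> g') \<cdot> (f \<boxtimes> f') = (g \<cdot> f) \<boxtimes> (g' \<cdot> f')"
  using interchange[of f "Dom C f" "Cod C f" g "Cod C g" f' "Dom C f'" "Cod C f'" g' "Cod C g'"]
  by (auto simp: Hom_iff)

text \<open>
  A point \<open>\<nu> : I \<rightarrow> V\<close> has no strand as input: by strictness \<open>\<nu> \<boxtimes> g\<close> has the domain of \<open>g\<close>. The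
  next two rules move everything composed with \<open>\<nu> \<boxtimes> g\<close>, before or after it, into the second factor.
\<close>

lemma point_tensor_Comp:
  assumes "\<nu> \<in> Hom C (unit_obj C) V" "g \<in> Arr C" "f \<in> Arr C" "Dom C g = Cod C f"
  shows "(\<nu> \<boxtimes> g) \<cdot> f = \<nu> \<boxtimes> (g \<cdot> f)"
  using Comp_tensor[of "Ident C (unit_obj C)" \<nu> f g] assms
  by (simp add: Hom_iff unit_arr_left)

lemma Ident_tensor_Comp_point_tensor:
  assumes "\<nu> \<in> Hom C (unit_obj C) V" "g \<in> Arr C" "h \<in> Arr C" "Dom C h = Cod C g"
  shows "(Ident C V \<boxtimes> h) \<cdot> (\<nu> \<boxtimes> g) = \<nu> \<boxtimes> (h \<cdot> g)"
  using assms by (auto simp: Hom_iff Comp_tensor)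

text \<open>
  A left inverse \<open>r\<close> of \<open>\<nu> \<boxtimes> Ident C Y\<close> recovers \<open>h\<close> as \<open>r \<cdot> (\<nu> \<boxtimes> h)\<close>, since
  \<open>\<nu> \<boxtimes> h = (\<nu> \<boxtimes> Ident C Y) \<cdot> h\<close>.
\<close>

lemma point_tensor_cancel:
  assumes "\<nu> \<in> Hom C (unit_obj C) V" "f \<in> Hom C X Y" "g \<in> Hom C X Y"
    and "r \<in> Hom C (V \<odot> Y) Y" "r \<cdot> (\<nu> \<boxtimes> Ident C Y) = Ident C Y"
    and "\<nu> \<boxtimes> f = \<nu> \<boxtimes> g"
  shows "f = g"
proof -
  have "r \<cdot> (\<nu> \<boxtimes> h) = h" if "h \<in> Hom C X Y" for h
  proof -
    from that have Y: "Y \<in> Obj C" by (auto simp: Hom_iff)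
    have "r \<cdot> (\<nu> \<boxtimes> h) = r \<cdot> ((\<nu> \<boxtimes> Ident C Y) \<cdot> h)"
      using that assms(1) Y by (simp add: Hom_iff point_tensor_Comp[OF assms(1)])
    also have "\<dots> = (r \<cdot> (\<nu> \<boxtimes> Ident C Y)) \<cdot> h"
      using that assms(1,4) Y by (subst Comp_assoc_Arr) (auto simp: Hom_iff)
    finally show ?thesis using that assms(5) by (simp add: Hom_iff)
  qed
  from this[OF assms(2)] this[OF assms(3)] assms(6) show ?thesis by metis
qed

text \<open>
  For a pointed \<open>f\<close>, both sides of the braided morphism condition are \<open>\<nu>'\<close> tensored with
  the corresponding side of the algebra morphism condition.
\<close>

lemma tensor_square_intertwines_point:
  assumes "\<nu> \<in> Hom C (unit_obj C) V" "\<mu> \<in> Hom C X V" "\<nu>' \<in> Hom C (unit_obj C) W"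
    "\<mu>' \<in> Hom C (W \<odot> W) W" "f \<in> Hom C V W" "f \<cdot> \<nu> = \<nu>'"
  shows "(f \<boxtimes> f) \<cdot> (\<nu> \<boxtimes> \<mu>) = \<nu>' \<boxtimes> (f \<cdot> \<mu>)"
    "(\<nu>' \<boxtimes> \<mu>') \<cdot> (f \<boxtimes> f) = \<nu>' \<boxtimes> (\<mu>' \<cdot> (f \<boxtimes> f))"
  using assms by (simp_all add: Hom_iff Comp_tensor point_tensor_Comp[OF assms(3)])


section \<open>The categories of pointed algebras and of pointed braided objects\<close>

lemma category_pointed_algebras:
  assumes "\<And>V \<mu> \<nu>. (V, \<mu>, \<nu>) \<in> S \<Longrightarrow>
    V \<in> Obj C \<and> \<mu> \<in> Hom C (V \<odot> V) V \<and> \<nu> \<in> Hom C (unit_obj C) V"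
  shows "category (structured_category C S (pointed_algebra_morphism C))"
proof (rule category_structured_category)
  show "category C" by unfold_locales
next
  fix A B D f g
  assume A: "A \<in> S" "B \<in> S" "D \<in> S" "f \<in> Hom C (fst A) (fst B)" "g \<in> Hom C (fst B) (fst D)"
    "pointed_algebra_morphism C A B f" "pointed_algebra_morphism C B D g"
  obtain V \<mu> \<nu> W \<mu>' \<nu>' U \<mu>'' \<nu>'' where eq: "A = (V, \<mu>, \<nu>)" "B = (W, \<mu>', \<nu>')" "D = (U, \<mu>'', \<nu>'')"
    by (metis prod.exhaust)
  note t = A(4,5) assms[OF A(1)[unfolded eq]] assms[OF A(2)[unfolded eq]]
    assms[OF A(3)[unfolded eq]]
  have f: "f \<cdot> \<mu> = \<mu>' \<cdot> (f \<boxtimes> f)" "f \<cdot> \<nu> = \<nu>'" and g: "g \<cdot> \<mu>' = \<mu>'' \<cdot> (g \<boxtimes> g)" "g \<cdot> \<nu>' = \<nu>''"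
    using A(6,7) by (auto simp: eq)
  have "(g \<cdot> f) \<cdot> \<mu> = g \<cdot> (\<mu>' \<cdot> (f \<boxtimes> f))"
    using t f by (simp add: eq Hom_iff Comp_assoc_Arr)
  also have "\<dots> = (g \<cdot> \<mu>') \<cdot> (f \<boxtimes> f)"
    using t by (simp add: eq Hom_iff Comp_assoc_Arr)
  also have "\<dots> = \<mu>'' \<cdot> ((g \<boxtimes> g) \<cdot> (f \<boxtimes> f))"
    unfolding g using t by (simp add: eq Hom_iff Comp_assoc_Arr)
  also have "\<dots> = \<mu>'' \<cdot> ((g \<cdot> f) \<boxtimes> (g \<cdot> f))"
    using t by (simp add: eq Hom_iff Comp_tensor)
  finally show "pointed_algebra_morphism C A D (g \<cdot> f)"
    using t f(2) g(2) by (simp add: eq Hom_iff Comp_assoc_Arr)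
qed (use assms in \<open>auto simp: Hom_iff tensor_Ident\<close>)

lemma category_Br_nu: "category (Br_nu C)"
  unfolding Br_nu_def
proof (rule category_structured_category)
  show "category C" by unfold_locales
next
  let ?S = "{(V, \<sigma>, \<nu>). V \<in> Obj C \<and> pre_braiding C V \<sigma> \<and> \<nu> \<in> Hom C (unit_obj C) V}"
  fix A B D f g
  assume A: "A \<in> ?S" "B \<in> ?S" "D \<in> ?S" "f \<in> Hom C (fst A) (fst B)" "g \<in> Hom C (fst B) (fst D)"
    "pointed_braided_morphism C A B f" "pointed_braided_morphism C B D g"
  obtain V \<sigma> \<nu> W \<sigma>' \<nu>' U \<sigma>'' \<nu>'' where eq: "A = (V, \<sigma>, \<nu>)" "B = (W, \<sigma>', \<nu>')" "D = (U, \<sigma>'', \<nu>'')"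
    by (metis prod.exhaust)
  note t = A(1-5)[unfolded eq pre_braiding_def]
  have f: "(f \<boxtimes> f) \<cdot> \<sigma> = \<sigma>' \<cdot> (f \<boxtimes> f)" "f \<cdot> \<nu> = \<nu>'"
    and g: "(g \<boxtimes> g) \<cdot> \<sigma>' = \<sigma>'' \<cdot> (g \<boxtimes> g)" "g \<cdot> \<nu>' = \<nu>''"
    using A(6,7) by (auto simp: eq)
  have gf: "(g \<cdot> f) \<boxtimes> (g \<cdot> f) = (g \<boxtimes> g) \<cdot> (f \<boxtimes> f)"
    using t by (simp add: Hom_iff Comp_tensor)
  have "((g \<boxtimes> g) \<cdot> (f \<boxtimes> f)) \<cdot> \<sigma> = (g \<boxtimes> g) \<cdot> (\<sigma>' \<cdot> (f \<boxtimes> f))"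
    using t f by (simp add: Hom_iff Comp_assoc_Arr)
  also have "\<dots> = ((g \<boxtimes> g) \<cdot> \<sigma>') \<cdot> (f \<boxtimes> f)"
    using t by (simp add: Hom_iff Comp_assoc_Arr)
  also have "\<dots> = \<sigma>'' \<cdot> ((g \<boxtimes> g) \<cdot> (f \<boxtimes> f))"
    unfolding g using t by (simp add: Hom_iff Comp_assoc_Arr)
  finally show "pointed_braided_morphism C A D (g \<cdot> f)"
    using t f(2) g(2) by (simp add: eq gf) (simp add: Hom_iff Comp_assoc_Arr)
qed (auto simp: Hom_iff tensor_Ident pre_braiding_def)


section \<open>Associative algebras\<close>

text \<open>
  Both composites are \<open>\<nu> \<boxtimes> \<nu> \<boxtimes> m\<close> with \<open>m\<close> the threefold product. On the left-hand side the two
  products are taken from the left, and the last \<open>\<sigma>\<close> only multiplies two units; on the right-hand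
  side the second \<open>\<sigma>\<close> multiplies by a unit on the right, and the products are taken from
  the right. Associativity makes the two agree.
\<close>

lemma pre_braiding_sigma_Ass:
  assumes "unital_assoc_algebra C V \<mu> \<nu>"
  shows "pre_braiding C V (\<nu> \<boxtimes> \<mu>)"
proof -
  have t: "V \<in> Obj C" "\<mu> \<in> Arr C" "Dom C \<mu> = V \<odot> V" "Cod C \<mu> = V"
    "\<nu> \<in> Arr C" "Dom C \<nu> = unit_obj C" "Cod C \<nu> = V"
    using assms by (auto simp: unital_assoc_algebra_def Hom_iff)
  have \<nu>: "\<nu> \<in> Hom C (unit_obj C) V" using t by (simp add: Hom_iff)
  let ?I = "Ident C V" and ?\<sigma> = "\<nu> \<boxtimes> \<mu>"
  let ?R = "\<nu> \<boxtimes> \<nu> \<boxtimes> (\<mu> \<cdot> (\<mu> \<boxtimes> ?I))"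
  have assoc: "\<mu> \<cdot> (?I \<boxtimes> \<mu>) = \<mu> \<cdot> (\<mu> \<boxtimes> ?I)"
    using assms by (simp add: unital_assoc_algebra_def)
  have unit: "\<mu> \<cdot> (\<nu> \<boxtimes> ?I) = ?I" "\<mu> \<cdot> (?I \<boxtimes> \<nu>) = ?I"
    using assms by (auto simp: unital_assoc_algebra_def)
  have mult_point: "\<mu> \<cdot> (\<nu> \<boxtimes> g) = g" if "g \<in> Arr C" "Cod C g = V" for g
  proof -
    have "\<mu> \<cdot> (\<nu> \<boxtimes> g) = \<mu> \<cdot> ((\<nu> \<boxtimes> ?I) \<cdot> g)"
      using that t by (simp add: point_tensor_Comp[OF \<nu>])
    also have "\<dots> = (\<mu> \<cdot> (\<nu> \<boxtimes> ?I)) \<cdot> g"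
      using that t by (simp add: Comp_assoc_Arr)
    finally show ?thesis
      using that unit by simp
  qed
  have 1: "(?I \<boxtimes> ?\<sigma>) \<cdot> (?\<sigma> \<boxtimes> ?I) = ?R"
    using t by (simp add: Ident_tensor_Comp_point_tensor[OF \<nu>] point_tensor_Comp[OF \<nu>]
        tensor_arr_assoc)
  have 2: "(?\<sigma> \<boxtimes> ?I) \<cdot> (?I \<boxtimes> ?\<sigma>) = \<nu> \<boxtimes> ?I \<boxtimes> \<mu>"
  proof -
    have "(?\<sigma> \<boxtimes> ?I) \<cdot> (?I \<boxtimes> ?\<sigma>) = \<nu> \<boxtimes> ((\<mu> \<boxtimes> ?I) \<cdot> ((?I \<boxtimes> \<nu>) \<boxtimes> \<mu>))"
      using t by (simp add: point_tensor_Comp[OF \<nu>] tensor_arr_assoc)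
    also have "(\<mu> \<boxtimes> ?I) \<cdot> ((?I \<boxtimes> \<nu>) \<boxtimes> \<mu>) = ?I \<boxtimes> \<mu>"
      using t by (subst Comp_tensor) (simp_all add: unit)
    finally show ?thesis .
  qed
  have "(?\<sigma> \<boxtimes> ?I) \<cdot> ?R = \<nu> \<boxtimes> ((\<mu> \<boxtimes> ?I) \<cdot> ((\<nu> \<boxtimes> \<nu>) \<boxtimes> (\<mu> \<cdot> (\<mu> \<boxtimes> ?I))))"
    using t by (simp add: point_tensor_Comp[OF \<nu>] tensor_arr_assoc)
  also have "(\<mu> \<boxtimes> ?I) \<cdot> ((\<nu> \<boxtimes> \<nu>) \<boxtimes> (\<mu> \<cdot> (\<mu> \<boxtimes> ?I))) = \<nu> \<boxtimes> (\<mu> \<cdot> (\<mu> \<boxtimes> ?I))"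
    using t by (subst Comp_tensor) (simp_all add: mult_point)
  finally have 3: "(?\<sigma> \<boxtimes> ?I) \<cdot> ?R = ?R" .
  have 4: "(?I \<boxtimes> ?\<sigma>) \<cdot> (\<nu> \<boxtimes> ?I \<boxtimes> \<mu>) = ?R"
    using t by (simp add: Ident_tensor_Comp_point_tensor[OF \<nu>] point_tensor_Comp[OF \<nu>] assoc)
  show ?thesis
    unfolding pre_braiding_def using t by (simp add: Hom_iff 1 2 3 4)
qed

text \<open>The multiplication retracts \<open>\<nu> \<boxtimes> Ident C V\<close> by the left unit law.\<close>

lemma unital_assoc_algebra_point_cancel:
  assumes "unital_assoc_algebra C V \<mu> \<nu>" "f \<in> Hom C X V" "g \<in> Hom C X V" "\<nu> \<boxtimes> f = \<nu> \<boxtimes> g"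
  shows "f = g"
  using assms(1) unfolding unital_assoc_algebra_def
  by (intro point_tensor_cancel[OF _ assms(2,3) _ _ assms(4)]) blast+

lemma full_subcategory_via_sigma_Ass:
  "full_subcategory_via (UAlg C) (Br_nu C) (sigma_Ass_obj C) (same_arrow (sigma_Ass_obj C))"
  unfolding UAlg_def Br_nu_def
proof (rule full_subcategory_via_structured)
  let ?S = "{(V, \<mu>, \<nu>). unital_assoc_algebra C V \<mu> \<nu>}"
  let ?T = "{(V, \<sigma>, \<nu>). V \<in> Obj C \<and> pre_braiding C V \<sigma> \<and> \<nu> \<in> Hom C (unit_obj C) V}"
  show "category (structured_category C ?S (pointed_algebra_morphism C))"
    by (rule category_pointed_algebras) (simp add: unital_assoc_algebra_def)
  show "category (structured_category C ?T (pointed_braided_morphism C))"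
    using category_Br_nu by (simp add: Br_nu_def)
  show "inj_on (sigma_Ass_obj C) ?S"
  proof (rule inj_onI)
    fix A B assume A: "A \<in> ?S" "B \<in> ?S" "sigma_Ass_obj C A = sigma_Ass_obj C B"
    then obtain V \<mu> \<mu>' \<nu> where eq: "A = (V, \<mu>, \<nu>)" "B = (V, \<mu>', \<nu>)" "\<nu> \<boxtimes> \<mu> = \<nu> \<boxtimes> \<mu>'"
      by (cases A; cases B) auto
    with A have "unital_assoc_algebra C V \<mu> \<nu>" "\<mu> \<in> Hom C (V \<odot> V) V" "\<mu>' \<in> Hom C (V \<odot> V) V"
      by (auto simp: unital_assoc_algebra_def)
    from unital_assoc_algebra_point_cancel[OF this eq(3)] show "A = B"
      by (simp add: eq)
  qed
  fix A assume A: "A \<in> ?S"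
  then show "fst (sigma_Ass_obj C A) = fst A"
    by auto
  obtain V \<mu> \<nu> where eq: "A = (V, \<mu>, \<nu>)"
    by (metis prod.exhaust)
  with A have alg: "unital_assoc_algebra C V \<mu> \<nu>"
    by simp
  then have t: "V \<in> Obj C" "\<nu> \<in> Hom C (unit_obj C) V" "\<mu> \<in> Hom C (V \<odot> V) V"
    by (auto simp: unital_assoc_algebra_def)
  show "sigma_Ass_obj C A \<in> ?T"
    using t pre_braiding_sigma_Ass[OF alg] by (simp add: eq)
  fix B f assume B: "B \<in> ?S" and f: "f \<in> Hom C (fst A) (fst B)"
  obtain W \<mu>' \<nu>' where eq': "B = (W, \<mu>', \<nu>')"
    by (metis prod.exhaust)
  with B have alg': "unital_assoc_algebra C W \<mu>' \<nu>'"
    by simp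
  then have t': "\<nu>' \<in> Hom C (unit_obj C) W" "\<mu>' \<in> Hom C (W \<odot> W) W"
    by (auto simp: unital_assoc_algebra_def)
  have f: "f \<in> Hom C V W"
    using f by (simp add: eq eq')
  have hom: "f \<cdot> \<mu> \<in> Hom C (V \<odot> V) W" "\<mu>' \<cdot> (f \<boxtimes> f) \<in> Hom C (V \<odot> V) W"
    using t t' f by (auto simp: Hom_iff)
  have "f \<cdot> \<mu> = \<mu>' \<cdot> (f \<boxtimes> f) \<longleftrightarrow> (f \<boxtimes> f) \<cdot> (\<nu> \<boxtimes> \<mu>) = (\<nu>' \<boxtimes> \<mu>') \<cdot> (f \<boxtimes> f)"
    if "f \<cdot> \<nu> = \<nu>'"
    using unital_assoc_algebra_point_cancel[OF alg' hom]
    unfolding tensor_square_intertwines_point[OF t(2,3) t' f that] by metis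
  then show "pointed_algebra_morphism C A B f \<longleftrightarrow>
      pointed_braided_morphism C (sigma_Ass_obj C A) (sigma_Ass_obj C B) f"
    by (auto simp: eq eq')
qed

end

section \<open>Leibniz algebras\<close>

context symmetric_strict_monoidal_category
begin

lemma braid_typing [simp]:
  assumes "X \<in> Obj C" "Y \<in> Obj C"
  shows "braid C X Y \<in> Arr C" "Dom C (braid C X Y) = X \<odot> Y" "Cod C (braid C X Y) = Y \<odot> X"
  using braid_in_Hom[OF assms] by (auto simp: Hom_iff)

lemma braid_natural_Arr:
  "\<lbrakk>f \<in> Arr C; g \<in> Arr C\<rbrakk> \<Longrightarrow>
    braid C (Cod C f) (Cod C g) \<cdot> (f \<boxtimes> g) = (g \<boxtimes> f) \<cdot> braid C (Dom C f) (Dom C g)"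
  using braid_natural[of f "Dom C f" "Cod C f" g "Dom C g" "Cod C g"] by (auto simp: Hom_iff)

text \<open>
  Braiding with \<open>I \<odot> I = I\<close> is, by the hexagon, braiding with \<open>I\<close> twice; so this braiding is idempotent.
  Being invertible by symmetry, it is the identity.
\<close>

lemma braid_unit_right [simp]:
  assumes X: "X \<in> Obj C"
  shows "braid C X (unit_obj C) = Ident C X"
proof -
  let ?b = "braid C X (unit_obj C)" and ?b' = "braid C (unit_obj C) X"
  have idem: "?b = ?b \<cdot> ?b"
    using hexagon_left[OF X unit_closed unit_closed] X by (simp add: unit_arr_left unit_arr_right)
  have inverse: "?b' \<cdot> ?b = Ident C X"
    using braid_symmetric[OF X unit_closed] X by simp
  have "?b = (?b' \<cdot> ?b) \<cdot> ?b"
    using X by (simp add: inverse)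
  also have "\<dots> = ?b' \<cdot> (?b \<cdot> ?b)"
    using X by (simp add: Comp_assoc_Arr)
  finally show ?thesis
    using idem inverse by simp
qed

lemma braid_Comp_tensor_point:
  assumes "\<nu> \<in> Hom C (unit_obj C) V" "f \<in> Arr C" "Cod C f = X"
  shows "braid C X V \<cdot> (f \<boxtimes> \<nu>) = \<nu> \<boxtimes> f"
  using braid_natural_Arr[of f \<nu>] assms by (auto simp: Hom_iff)

end

context symmetric_preadditive_strict_monoidal_category
begin

lemma hom_add_laws:
  assumes "X \<in> Obj C" "Y \<in> Obj C"
  shows hom_add_closed: "\<lbrakk>f \<in> Hom C X Y; g \<in> Hom C X Y\<rbrakk> \<Longrightarrow> f \<boxplus> g \<in> Hom C X Y"
    and hom_zero_closed: "hom_zero C X Y \<in> Hom C X Y"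
    and hom_add_assoc: "\<lbrakk>f \<in> Hom C X Y; g \<in> Hom C X Y; h \<in> Hom C X Y\<rbrakk>
      \<Longrightarrow> (f \<boxplus> g) \<boxplus> h = f \<boxplus> (g \<boxplus> h)"
    and hom_add_comm: "\<lbrakk>f \<in> Hom C X Y; g \<in> Hom C X Y\<rbrakk> \<Longrightarrow> f \<boxplus> g = g \<boxplus> f"
    and hom_add_zero_left: "f \<in> Hom C X Y \<Longrightarrow> hom_zero C X Y \<boxplus> f = f"
    and hom_add_zero_right: "f \<in> Hom C X Y \<Longrightarrow> f \<boxplus> hom_zero C X Y = f"
    and hom_add_left_cancel: "\<lbrakk>f \<in> Hom C X Y; g \<in> Hom C X Y; h \<in> Hom C X Y\<rbrakk>
      \<Longrightarrow> f \<boxplus> g = f \<boxplus> h \<longleftrightarrow> g = h"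
    and hom_diff_add: "\<lbrakk>f \<in> Hom C X Y; g \<in> Hom C X Y\<rbrakk> \<Longrightarrow> hom_diff C X Y f g \<boxplus> g = f"
proof -
  interpret H: comm_group "hom_group C X Y" by (rule hom_comm_group[OF assms])
  have [simp]: "carrier (hom_group C X Y) = Hom C X Y" "mult (hom_group C X Y) = hom_add C"
    "one (hom_group C X Y) = hom_zero C X Y"
    by (simp_all add: hom_group_def)
  note H.m_closed [simplified, simp] H.inv_closed [simplified, simp]
  show "\<lbrakk>f \<in> Hom C X Y; g \<in> Hom C X Y\<rbrakk> \<Longrightarrow> f \<boxplus> g \<in> Hom C X Y"
    by simp
  show "hom_zero C X Y \<in> Hom C X Y"
    using H.one_closed by simp
  show assoc: "\<lbrakk>f \<in> Hom C X Y; g \<in> Hom C X Y; h \<in> Hom C X Y\<rbrakk>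
      \<Longrightarrow> (f \<boxplus> g) \<boxplus> h = f \<boxplus> (g \<boxplus> h)" for f g h
    using H.m_assoc[of f g h] by simp
  show "\<lbrakk>f \<in> Hom C X Y; g \<in> Hom C X Y\<rbrakk> \<Longrightarrow> f \<boxplus> g = g \<boxplus> f"
    using H.m_comm[of f g] by simp
  show "f \<in> Hom C X Y \<Longrightarrow> hom_zero C X Y \<boxplus> f = f"
    using H.l_one[of f] by simp
  show right: "f \<in> Hom C X Y \<Longrightarrow> f \<boxplus> hom_zero C X Y = f"
    using H.r_one[of f] by simp
  show "\<lbrakk>f \<in> Hom C X Y; g \<in> Hom C X Y; h \<in> Hom C X Y\<rbrakk>
      \<Longrightarrow> f \<boxplus> g = f \<boxplus> h \<longleftrightarrow> g = h"
    using H.Units_l_cancel[of f g h] by auto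
  show "\<lbrakk>f \<in> Hom C X Y; g \<in> Hom C X Y\<rbrakk> \<Longrightarrow> hom_diff C X Y f g \<boxplus> g = f"
    using H.l_inv[of g] assoc[of f "inv\<^bsub>hom_group C X Y\<^esub> g" g] right by (simp add: hom_diff_def)
qed

text \<open>
  Composing or tensoring with a zero arrow gives a zero arrow by distributivity, since
  the result is idempotent for addition.
\<close>

lemma hom_add_idem_imp_zero:
  assumes "f \<in> Hom C X Y" "f \<boxplus> f = f"
  shows "f = hom_zero C X Y"
proof -
  from assms(1) have "X \<in> Obj C" "Y \<in> Obj C" by (auto simp: Hom_iff)
  then show ?thesis
    using hom_add_left_cancel[of X Y f f "hom_zero C X Y"] assms
    by (simp add: hom_add_zero_right hom_zero_closed)
qed

lemma hom_zero_tensor_left: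
  assumes "X \<in> Obj C" "Y \<in> Obj C" "f \<in> Hom C X' Y'"
  shows "hom_zero C X Y \<boxtimes> f = hom_zero C (X \<odot> X') (Y \<odot> Y')"
  using assms tensor_add_left[of "hom_zero C X Y" X Y "hom_zero C X Y" f X' Y']
  by (intro hom_add_idem_imp_zero tensor_in_Hom)
    (simp_all add: hom_zero_closed hom_add_zero_left)

lemma hom_zero_tensor_right:
  assumes "X \<in> Obj C" "Y \<in> Obj C" "f \<in> Hom C X' Y'"
  shows "f \<boxtimes> hom_zero C X Y = hom_zero C (X' \<odot> X) (Y' \<odot> Y)"
  using assms tensor_add_right[of f X' Y' "hom_zero C X Y" X Y "hom_zero C X Y"]
  by (intro hom_add_idem_imp_zero tensor_in_Hom)
    (simp_all add: hom_zero_closed hom_add_zero_left)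

lemma Comp_hom_zero:
  assumes "X \<in> Obj C" "f \<in> Hom C Y Z"
  shows "f \<cdot> hom_zero C X Y = hom_zero C X Z"
proof -
  have "Y \<in> Obj C" using assms by (auto simp: Hom_iff)
  then show ?thesis
    using assms Comp_add_right[of "hom_zero C X Y" X Y "hom_zero C X Y" f Z]
    by (intro hom_add_idem_imp_zero Comp_in_Hom[of _ X Y])
      (simp_all add: hom_zero_closed hom_add_zero_left)
qed

lemma hom_zero_Comp:
  assumes "Z \<in> Obj C" "f \<in> Hom C X Y"
  shows "hom_zero C Y Z \<cdot> f = hom_zero C X Z"
proof -
  have "Y \<in> Obj C" using assms by (auto simp: Hom_iff)
  then show ?thesis
    using assms Comp_add_left[of f X Y "hom_zero C Y Z" Z "hom_zero C Y Z"]
    by (intro hom_add_idem_imp_zero Comp_in_Hom[of _ X Y])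
      (simp_all add: hom_zero_closed hom_add_zero_left)
qed

text \<open>
  When a solution \<open>c\<close> of the Yang--Baxter equation is perturbed by \<open>b\<close>, each side expands into eight
  terms. Here \<open>c1, b1\<close> and \<open>c2, b2\<close> stand for \<open>c, b\<close> acting on the first two and on the last two of
  three strands. The hypotheses say how the terms are to be paired: those of degree
  at most one in \<open>b\<close> match one by one, all others vanish except the three in \<open>leibniz\<close>.
\<close>

lemma yang_baxter_add:
  assumes hom: "c1 \<in> Hom C X X" "c2 \<in> Hom C X X" "b1 \<in> Hom C X X" "b2 \<in> Hom C X X"
    and c: "c1 \<cdot> c2 \<cdot> c1 = c2 \<cdot> c1 \<cdot> c2"
    and slide: "c1 \<cdot> c2 \<cdot> b1 = b2 \<cdot> c1 \<cdot> c2" "b1 \<cdot> c2 \<cdot> c1 = c2 \<cdot> c1 \<cdot> b2"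
      "c1 \<cdot> b2 \<cdot> c1 = c2 \<cdot> b1 \<cdot> c2"
    and zero: "b1 \<cdot> b2 = hom_zero C X X" "b1 \<cdot> c2 \<cdot> b1 = hom_zero C X X"
    and leibniz: "c1 \<cdot> b2 \<cdot> b1 = (b2 \<cdot> c1 \<cdot> b2) \<boxplus> (b2 \<cdot> b1 \<cdot> c2)"
  shows "(c1 \<boxplus> b1) \<cdot> (c2 \<boxplus> b2) \<cdot> (c1 \<boxplus> b1) = (c2 \<boxplus> b2) \<cdot> (c1 \<boxplus> b1) \<cdot> (c2 \<boxplus> b2)"
proof -
  have X: "X \<in> Obj C" using hom(1) by (auto simp: Hom_iff)
  have closed: "g \<cdot> f \<in> Hom C X X" "f \<boxplus> g \<in> Hom C X X"
    if "f \<in> Hom C X X" "g \<in> Hom C X X" for f g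
    using that Comp_in_Hom hom_add_closed[OF X X] by auto
  have distrib: "(f \<boxplus> g) \<cdot> h = f \<cdot> h \<boxplus> g \<cdot> h" "h \<cdot> (f \<boxplus> g) = h \<cdot> f \<boxplus> h \<cdot> g"
    if "f \<in> Hom C X X" "g \<in> Hom C X X" "h \<in> Hom C X X" for f g h
    using that Comp_add_left Comp_add_right by auto
  have lcomm: "f \<boxplus> (g \<boxplus> h) = g \<boxplus> (f \<boxplus> h)"
    if "f \<in> Hom C X X" "g \<in> Hom C X X" "h \<in> Hom C X X" for f g h
    using that by (metis hom_add_assoc[OF X X] hom_add_comm[OF X X])
  note ac = hom_add_assoc[OF X X] hom_add_comm[OF X X] lcomm
  have b1b2: "b1 \<cdot> b2 \<cdot> f = hom_zero C X X" if "f \<in> Hom C X X" for f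
    using Comp_assoc[OF that hom(4,3)] zero(1) hom_zero_Comp[OF X that] by simp
  have zero': "c2 \<cdot> b1 \<cdot> b2 = hom_zero C X X" "b2 \<cdot> b1 \<cdot> b2 = hom_zero C X X"
    using zero(1) Comp_hom_zero[OF X] hom by auto
  note zeros = zero(2) zero' b1b2[OF hom(1)] b1b2[OF hom(3)]
    hom_add_zero_left[OF X X] hom_add_zero_right[OF X X]
  have "(c1 \<boxplus> b1) \<cdot> (c2 \<boxplus> b2) \<cdot> (c1 \<boxplus> b1) =
      (c1 \<cdot> c2 \<cdot> c1 \<boxplus> c1 \<cdot> c2 \<cdot> b1 \<boxplus> c1 \<cdot> b2 \<cdot> c1 \<boxplus> c1 \<cdot> b2 \<cdot> b1) \<boxplus>
      (b1 \<cdot> c2 \<cdot> c1 \<boxplus> b1 \<cdot> c2 \<cdot> b1 \<boxplus> b1 \<cdot> b2 \<cdot> c1 \<boxplus> b1 \<cdot> b2 \<cdot> b1)"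
    by (simp add: distrib closed hom ac)
  also have "\<dots> = c2 \<cdot> c1 \<cdot> c2 \<boxplus> b2 \<cdot> c1 \<cdot> c2 \<boxplus> c2 \<cdot> b1 \<cdot> c2 \<boxplus>
      ((b2 \<cdot> c1 \<cdot> b2) \<boxplus> (b2 \<cdot> b1 \<cdot> c2)) \<boxplus> c2 \<cdot> c1 \<cdot> b2"
    unfolding c slide leibniz zeros(1,4,5) by (simp add: zeros(6-) closed hom)
  also have "\<dots> = (c2 \<cdot> c1 \<cdot> c2 \<boxplus> c2 \<cdot> c1 \<cdot> b2 \<boxplus> c2 \<cdot> b1 \<cdot> c2 \<boxplus> c2 \<cdot> b1 \<cdot> b2) \<boxplus>
      (b2 \<cdot> c1 \<cdot> c2 \<boxplus> b2 \<cdot> c1 \<cdot> b2 \<boxplus> b2 \<cdot> b1 \<cdot> c2 \<boxplus> b2 \<cdot> b1 \<cdot> b2)"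
    unfolding zeros(2,3) by (simp add: zeros(6-) closed hom ac)
  also have "\<dots> = (c2 \<boxplus> b2) \<cdot> (c1 \<boxplus> b1) \<cdot> (c2 \<boxplus> b2)"
    by (simp add: distrib closed hom ac)
  finally show ?thesis .
qed

text \<open>
  The pairing of terms required by \<open>yang_baxter_add\<close>, for \<open>\<beta> = \<nu> \<boxtimes> br\<close>. When \<open>\<beta>\<close> is the first or the
  last of the three factors, naturality moves it past the other two whatever \<open>\<beta>\<close>
  is. When it is the middle one, its special form is needed: the unit it produces passes through
  the braiding freely. The products \<open>\<beta>1 \<cdot> \<beta>2\<close> and \<open>\<beta>1 \<cdot> c2 \<cdot> \<beta>1\<close> bracket with a unit, so they vanish.
\<close>

lemma pre_braiding_sigma_Lei:
  assumes "unital_leibniz_algebra C V br \<nu>"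
  shows "pre_braiding C V (braid C V V \<boxplus> (\<nu> \<boxtimes> br))"
proof -
  let ?I = "Ident C V" and ?c = "braid C V V" and ?\<beta> = "\<nu> \<boxtimes> br"
  let ?V2 = "V \<odot> V" and ?V3 = "V \<odot> V \<odot> V"
  have V: "V \<in> Obj C" and \<nu>: "\<nu> \<in> Hom C (unit_obj C) V" and br: "br \<in> Hom C ?V2 V"
    and null: "br \<cdot> (?I \<boxtimes> \<nu>) = hom_zero C V V" "br \<cdot> (\<nu> \<boxtimes> ?I) = hom_zero C V V"
    and jacobi: "br \<cdot> (?I \<boxtimes> br) = hom_diff C ?V3 V
      (br \<cdot> (br \<boxtimes> ?I)) (br \<cdot> (br \<boxtimes> ?I) \<cdot> (?I \<boxtimes> ?c))"
    using assms by (auto simp: unital_leibniz_algebra_def)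
  note t = V \<nu>[unfolded Hom_iff] br[unfolded Hom_iff]
  note pc = point_tensor_Comp[OF \<nu>] Ident_tensor_Comp_point_tensor[OF \<nu>]
  define c1 c2 \<beta>1 \<beta>2 where def: "c1 = ?c \<boxtimes> ?I" "c2 = ?I \<boxtimes> ?c" "\<beta>1 = ?\<beta> \<boxtimes> ?I" "\<beta>2 = ?I \<boxtimes> ?\<beta>"
  have hom: "c1 \<in> Hom C ?V3 ?V3" "c2 \<in> Hom C ?V3 ?V3" "\<beta>1 \<in> Hom C ?V3 ?V3" "\<beta>2 \<in> Hom C ?V3 ?V3"
    unfolding def using t by (auto simp: Hom_iff)
  have \<beta>1: "\<beta>1 = \<nu> \<boxtimes> (br \<boxtimes> ?I)"
    unfolding def using t by (simp add: tensor_arr_assoc)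
  have hex: "braid C V ?V2 = c2 \<cdot> c1" "braid C ?V2 V = c1 \<cdot> c2"
    unfolding def using hexagon_left[OF V V V] hexagon_right[OF V V V] by auto
  \<comment> \<open>Naturality for any endomorphism \<open>f\<close> of \<open>V \<odot> V\<close>: the case \<open>f = ?c\<close> is the Yang--Baxter equation
    for \<open>?c\<close>, the case \<open>f = ?\<beta>\<close> gives the terms with \<open>\<beta>\<close> at one end.\<close>
  have slide: "c2 \<cdot> c1 \<cdot> (?I \<boxtimes> f) = (f \<boxtimes> ?I) \<cdot> c2 \<cdot> c1" "c1 \<cdot> c2 \<cdot> (f \<boxtimes> ?I) = (?I \<boxtimes> f) \<cdot> c1 \<cdot> c2"
    if f: "f \<in> Hom C ?V2 ?V2" for f
    using braid_natural_Arr[of ?I f] braid_natural_Arr[of f ?I] f hom V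
    by (auto simp: Hom_iff hex Comp_assoc_Arr)
  have c\<beta>: "?c \<in> Hom C ?V2 ?V2" "?\<beta> \<in> Hom C ?V2 ?V2"
    using t by (auto simp: Hom_iff)
  have c2c2: "c2 \<cdot> c2 = Ident C ?V3"
    unfolding def using V by (simp add: Comp_tensor braid_symmetric tensor_Ident)
  have natural_br: "?c \<cdot> (br \<boxtimes> ?I) = (?I \<boxtimes> br) \<cdot> c1 \<cdot> c2"
    using braid_natural_Arr[of br ?I] t by (simp add: hex)
  \<comment> \<open>The unit created by \<open>\<beta>\<close> in the second position moves to the first one.\<close>
  have c1\<beta>2: "c1 \<cdot> \<beta>2 = \<nu> \<boxtimes> (?I \<boxtimes> br)"
  proof -
    have "c1 \<cdot> \<beta>2 = (?c \<boxtimes> ?I) \<cdot> ((?I \<boxtimes> \<nu>) \<boxtimes> br)"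
      unfolding def using t by (simp add: tensor_arr_assoc)
    also have "\<dots> = (\<nu> \<boxtimes> ?I) \<boxtimes> br"
      using t by (subst Comp_tensor) (simp_all add: braid_Comp_tensor_point[OF \<nu>])
    finally show ?thesis
      using t by (simp add: tensor_arr_assoc)
  qed
  have br_point: "(br \<boxtimes> ?I) \<cdot> ((?I \<boxtimes> \<nu>) \<boxtimes> br) = hom_zero C ?V3 ?V2"
    "(br \<boxtimes> ?I) \<cdot> ((\<nu> \<boxtimes> ?I) \<boxtimes> br) = hom_zero C ?V3 ?V2"
    using t by (simp_all add: Comp_tensor null hom_zero_tensor_left[OF V V br])
  have \<beta>1_null: "\<beta>1 \<cdot> \<beta>2 = hom_zero C ?V3 ?V3" "\<beta>1 \<cdot> (\<nu> \<boxtimes> (?I \<boxtimes> br)) = hom_zero C ?V3 ?V3"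
  proof -
    have zero: "\<nu> \<boxtimes> hom_zero C ?V3 ?V2 = hom_zero C ?V3 ?V3"
      using hom_zero_tensor_right[OF _ _ \<nu>, of ?V3 ?V2] V by simp
    have "\<beta>1 \<cdot> \<beta>2 = \<nu> \<boxtimes> ((br \<boxtimes> ?I) \<cdot> ((?I \<boxtimes> \<nu>) \<boxtimes> br))"
      unfolding \<beta>1 def(4) using t by (simp add: pc tensor_arr_assoc)
    then show "\<beta>1 \<cdot> \<beta>2 = hom_zero C ?V3 ?V3"
      by (simp only: br_point zero)
    have "\<beta>1 \<cdot> (\<nu> \<boxtimes> (?I \<boxtimes> br)) = \<nu> \<boxtimes> ((br \<boxtimes> ?I) \<cdot> ((\<nu> \<boxtimes> ?I) \<boxtimes> br))"
      unfolding \<beta>1 using t by (simp add: pc tensor_arr_assoc)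
    then show "\<beta>1 \<cdot> (\<nu> \<boxtimes> (?I \<boxtimes> br)) = hom_zero C ?V3 ?V3"
      by (simp only: br_point zero)
  qed
  have \<beta>2\<beta>1: "\<beta>2 \<cdot> \<beta>1 = \<nu> \<boxtimes> (\<nu> \<boxtimes> (br \<cdot> (br \<boxtimes> ?I)))"
    unfolding \<beta>1 def(4) using t by (simp add: pc)
  \<comment> \<open>Same value as \<open>\<beta>2 \<cdot> \<beta>1\<close>: here \<open>c1\<close> merely exchanges two units.\<close>
  have c1\<beta>2\<beta>1: "c1 \<cdot> \<beta>2 \<cdot> \<beta>1 = \<nu> \<boxtimes> (\<nu> \<boxtimes> (br \<cdot> (br \<boxtimes> ?I)))"
  proof -
    have "c1 \<cdot> \<beta>2 \<cdot> \<beta>1 = (c1 \<cdot> \<beta>2) \<cdot> \<beta>1"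
      using hom by (simp add: Hom_iff Comp_assoc_Arr)
    also have "\<dots> = \<nu> \<boxtimes> ((?I \<boxtimes> br) \<cdot> (\<nu> \<boxtimes> (br \<boxtimes> ?I)))"
      unfolding c1\<beta>2 \<beta>1 using t by (simp add: pc)
    also have "\<dots> = \<nu> \<boxtimes> (\<nu> \<boxtimes> (br \<cdot> (br \<boxtimes> ?I)))"
      using t by (simp add: pc)
    finally show ?thesis .
  qed
  have "(c1 \<boxplus> \<beta>1) \<cdot> (c2 \<boxplus> \<beta>2) \<cdot> (c1 \<boxplus> \<beta>1) = (c2 \<boxplus> \<beta>2) \<cdot> (c1 \<boxplus> \<beta>1) \<cdot> (c2 \<boxplus> \<beta>2)"
  proof (rule yang_baxter_add[OF hom])
    show "c1 \<cdot> c2 \<cdot> c1 = c2 \<cdot> c1 \<cdot> c2" "c1 \<cdot> c2 \<cdot> \<beta>1 = \<beta>2 \<cdot> c1 \<cdot> c2" "\<beta>1 \<cdot> c2 \<cdot> c1 = c2 \<cdot> c1 \<cdot> \<beta>2"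
      using slide(1)[OF c\<beta>(1)] slide[OF c\<beta>(2)] by (simp_all add: def)
    have "c1 \<cdot> \<beta>2 \<cdot> c1 = (c1 \<cdot> \<beta>2) \<cdot> c1"
      using hom by (simp add: Hom_iff Comp_assoc_Arr)
    then have "c1 \<cdot> \<beta>2 \<cdot> c1 = \<nu> \<boxtimes> ((?I \<boxtimes> br) \<cdot> c1)"
      unfolding c1\<beta>2 using t hom by (simp add: Hom_iff pc)
    moreover have "c2 \<cdot> \<beta>1 \<cdot> c2 = \<nu> \<boxtimes> (?c \<cdot> (br \<boxtimes> ?I) \<cdot> c2)"
      unfolding \<beta>1 def(2) using t by (simp add: pc)
    moreover have "?c \<cdot> (br \<boxtimes> ?I) \<cdot> c2 = (?I \<boxtimes> br) \<cdot> c1 \<cdot> c2 \<cdot> c2"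
    proof -
      have "?c \<cdot> (br \<boxtimes> ?I) \<cdot> c2 = (?c \<cdot> (br \<boxtimes> ?I)) \<cdot> c2"
        using t hom by (simp add: Hom_iff Comp_assoc_Arr)
      then show ?thesis
        unfolding natural_br using t hom by (simp add: Hom_iff Comp_assoc_Arr)
    qed
    ultimately show "c1 \<cdot> \<beta>2 \<cdot> c1 = c2 \<cdot> \<beta>1 \<cdot> c2"
      using hom by (simp add: c2c2 Hom_iff)
    show "\<beta>1 \<cdot> \<beta>2 = hom_zero C ?V3 ?V3" by (fact \<beta>1_null)
    have "c2 \<cdot> \<beta>1 = \<nu> \<boxtimes> (?c \<cdot> (br \<boxtimes> ?I))"
      unfolding \<beta>1 def(2) using t by (simp add: pc)
    also have "\<dots> = (\<nu> \<boxtimes> (?I \<boxtimes> br)) \<cdot> c1 \<cdot> c2"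
      unfolding natural_br using t hom by (simp add: Hom_iff pc)
    finally have "\<beta>1 \<cdot> c2 \<cdot> \<beta>1 = (\<beta>1 \<cdot> (\<nu> \<boxtimes> (?I \<boxtimes> br))) \<cdot> c1 \<cdot> c2"
      using t hom by (simp add: Hom_iff Comp_assoc_Arr)
    also have "\<dots> = hom_zero C ?V3 ?V3"
      unfolding \<beta>1_null using V hom by (intro hom_zero_Comp) (auto simp: Hom_iff)
    finally show "\<beta>1 \<cdot> c2 \<cdot> \<beta>1 = hom_zero C ?V3 ?V3" .
    let ?P = "br \<cdot> (?I \<boxtimes> br)" and ?Q = "br \<cdot> (br \<boxtimes> ?I) \<cdot> c2"
    have PQ: "?P \<in> Hom C ?V3 V" "?Q \<in> Hom C ?V3 V" "br \<cdot> (br \<boxtimes> ?I) \<in> Hom C ?V3 V"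
      using t hom by (auto simp: Hom_iff)
    have "?P \<boxplus> ?Q = br \<cdot> (br \<boxtimes> ?I)"
      unfolding jacobi def(2)[symmetric] using PQ V by (intro hom_diff_add) auto
    then have "\<nu> \<boxtimes> (\<nu> \<boxtimes> (br \<cdot> (br \<boxtimes> ?I))) = \<nu> \<boxtimes> (\<nu> \<boxtimes> (?P \<boxplus> ?Q))"
      by simp
    also have "\<dots> = \<nu> \<boxtimes> (\<nu> \<boxtimes> ?P) \<boxplus> \<nu> \<boxtimes> (\<nu> \<boxtimes> ?Q)"
      using tensor_add_right[OF \<nu> PQ(1,2)]
        tensor_add_right[OF \<nu> tensor_in_Hom[OF \<nu> PQ(1)] tensor_in_Hom[OF \<nu> PQ(2)]] by simp
    also have "\<nu> \<boxtimes> (\<nu> \<boxtimes> ?P) = \<beta>2 \<cdot> c1 \<cdot> \<beta>2"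
      unfolding c1\<beta>2 unfolding def(4) using t by (simp add: pc)
    also have "\<nu> \<boxtimes> (\<nu> \<boxtimes> ?Q) = (\<beta>2 \<cdot> \<beta>1) \<cdot> c2"
      unfolding \<beta>2\<beta>1 using t hom by (simp add: Hom_iff pc Comp_assoc_Arr)
    also have "\<dots> = \<beta>2 \<cdot> \<beta>1 \<cdot> c2"
      using hom by (simp add: Hom_iff Comp_assoc_Arr)
    finally show "c1 \<cdot> \<beta>2 \<cdot> \<beta>1 = (\<beta>2 \<cdot> c1 \<cdot> \<beta>2) \<boxplus> (\<beta>2 \<cdot> \<beta>1 \<cdot> c2)"
      unfolding c1\<beta>2\<beta>1 .
  qed
  moreover have "(?c \<boxplus> ?\<beta>) \<boxtimes> ?I = c1 \<boxplus> \<beta>1" "?I \<boxtimes> (?c \<boxplus> ?\<beta>) = c2 \<boxplus> \<beta>2"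
    unfolding def using tensor_add_left[OF c\<beta> Ident_in_Hom[OF V]]
      tensor_add_right[OF Ident_in_Hom[OF V] c\<beta>] by auto
  ultimately show ?thesis
    unfolding pre_braiding_def using hom_add_closed[OF _ _ c\<beta>] V by simp
qed

text \<open>With \<open>\<gamma> \<cdot> \<nu> = Ident C I\<close>, the arrow \<open>\<gamma> \<boxtimes> Ident C Y\<close> retracts \<open>\<nu> \<boxtimes> Ident C Y\<close>.\<close>

lemma normalized_point_cancel:
  assumes "has_normalized_morphism C V \<nu>" "\<nu> \<in> Hom C (unit_obj C) V"
    and "f \<in> Hom C X Y" "g \<in> Hom C X Y" "\<nu> \<boxtimes> f = \<nu> \<boxtimes> g"
  shows "f = g"
proof -
  obtain \<gamma> where \<gamma>: "\<gamma> \<in> Hom C V (unit_obj C)" "\<gamma> \<cdot> \<nu> = Ident C (unit_obj C)"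
    using assms(1) by (auto simp: has_normalized_morphism_def)
  have Y: "Y \<in> Obj C"
    using assms(3) by (auto simp: Hom_iff)
  show ?thesis
  proof (rule point_tensor_cancel[OF assms(2,3,4) _ _ assms(5)])
    show "\<gamma> \<boxtimes> Ident C Y \<in> Hom C (V \<odot> Y) Y"
      using \<gamma>(1) Y by (auto simp: Hom_iff)
    show "(\<gamma> \<boxtimes> Ident C Y) \<cdot> (\<nu> \<boxtimes> Ident C Y) = Ident C Y"
      using \<gamma> assms(2) Y by (simp add: Hom_iff Comp_tensor unit_arr_left)
  qed
qed

lemma full_subcategory_via_sigma_Lei:
  "full_subcategory_via (ULei_star C) (Br_nu C) (sigma_Lei_obj C) (same_arrow (sigma_Lei_obj C))"
  unfolding ULei_star_def Br_nu_def
proof (rule full_subcategory_via_structured)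
  let ?S = "{(V, br, \<nu>). unital_leibniz_algebra C V br \<nu> \<and> has_normalized_morphism C V \<nu>}"
  let ?T = "{(V, \<sigma>, \<nu>). V \<in> Obj C \<and> pre_braiding C V \<sigma> \<and> \<nu> \<in> Hom C (unit_obj C) V}"
  show "category (structured_category C ?S (pointed_algebra_morphism C))"
    by (rule category_pointed_algebras) (simp add: unital_leibniz_algebra_def)
  show "category (structured_category C ?T (pointed_braided_morphism C))"
    using category_Br_nu by (simp add: Br_nu_def)
  have typing: "V \<in> Obj C" "\<nu> \<in> Hom C (unit_obj C) V" "br \<in> Hom C (V \<odot> V) V"
    "braid C V V \<in> Hom C (V \<odot> V) (V \<odot> V)" "\<nu> \<boxtimes> br \<in> Hom C (V \<odot> V) (V \<odot> V)"
    if "unital_leibniz_algebra C V br \<nu>" for V br \<nu>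
    using that by (auto simp: unital_leibniz_algebra_def Hom_iff)
  show "inj_on (sigma_Lei_obj C) ?S"
  proof (rule inj_onI)
    fix A B assume A: "A \<in> ?S" "B \<in> ?S" "sigma_Lei_obj C A = sigma_Lei_obj C B"
    then obtain V br br' \<nu> where eq: "A = (V, br, \<nu>)" "B = (V, br', \<nu>)"
      and sum: "braid C V V \<boxplus> (\<nu> \<boxtimes> br) = braid C V V \<boxplus> (\<nu> \<boxtimes> br')"
      by (cases A; cases B) auto
    with A have alg: "unital_leibniz_algebra C V br \<nu>" "unital_leibniz_algebra C V br' \<nu>"
      and normalized: "has_normalized_morphism C V \<nu>" by auto
    note t = typing[OF alg(1)] and t' = typing[OF alg(2)]
    have "\<nu> \<boxtimes> br = \<nu> \<boxtimes> br'"
      using sum hom_add_left_cancel[OF _ _ t(4,5) t'(5)] t(1) by simp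
    from normalized_point_cancel[OF normalized t(2,3) t'(3) this] show "A = B"
      by (simp add: eq)
  qed
  fix A assume A: "A \<in> ?S"
  then show "fst (sigma_Lei_obj C A) = fst A"
    by auto
  obtain V br \<nu> where eq: "A = (V, br, \<nu>)"
    by (metis prod.exhaust)
  with A have alg: "unital_leibniz_algebra C V br \<nu>"
    by simp
  note t = typing[OF this]
  show "sigma_Lei_obj C A \<in> ?T"
    using t pre_braiding_sigma_Lei[OF alg] by (simp add: eq)
  fix B f assume B: "B \<in> ?S" and f: "f \<in> Hom C (fst A) (fst B)"
  obtain W br' \<nu>' where eq': "B = (W, br', \<nu>')"
    by (metis prod.exhaust)
  with B have alg': "unital_leibniz_algebra C W br' \<nu>'" "has_normalized_morphism C W \<nu>'"
    by auto
  note t' = typing[OF alg'(1)]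
  have f: "f \<in> Hom C V W"
    using f by (simp add: eq eq')
  have ff: "f \<boxtimes> f \<in> Hom C (V \<odot> V) (W \<odot> W)"
    using f by (rule tensor_in_Hom[OF _ f])
  have hom: "f \<cdot> br \<in> Hom C (V \<odot> V) W" "br' \<cdot> (f \<boxtimes> f) \<in> Hom C (V \<odot> V) W"
    using t t' f by (auto simp: Hom_iff)
  have "f \<cdot> br = br' \<cdot> (f \<boxtimes> f) \<longleftrightarrow>
      (f \<boxtimes> f) \<cdot> (braid C V V \<boxplus> (\<nu> \<boxtimes> br)) = (braid C W W \<boxplus> (\<nu>' \<boxtimes> br')) \<cdot> (f \<boxtimes> f)"
    if point: "f \<cdot> \<nu> = \<nu>'"
  proof -
    note square = tensor_square_intertwines_point[OF t(2,3) t'(2,3) f point]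
    let ?c = "(f \<boxtimes> f) \<cdot> braid C V V"
    have "(f \<boxtimes> f) \<cdot> (braid C V V \<boxplus> (\<nu> \<boxtimes> br)) = ?c \<boxplus> (\<nu>' \<boxtimes> (f \<cdot> br))"
      using Comp_add_right[OF t(4,5) ff] by (simp add: square)
    moreover have "(braid C W W \<boxplus> (\<nu>' \<boxtimes> br')) \<cdot> (f \<boxtimes> f) = ?c \<boxplus> (\<nu>' \<boxtimes> (br' \<cdot> (f \<boxtimes> f)))"
      using Comp_add_left[OF ff t'(4,5)] by (simp add: square braid_natural[OF f f])
    moreover have "?c \<boxplus> (\<nu>' \<boxtimes> g) = ?c \<boxplus> (\<nu>' \<boxtimes> h) \<longleftrightarrow> \<nu>' \<boxtimes> g = \<nu>' \<boxtimes> h"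
      if "g \<in> Hom C (V \<odot> V) W" "h \<in> Hom C (V \<odot> V) W" for g h
      using that t t' f
      by (intro hom_add_left_cancel[of "V \<odot> V" "W \<odot> W"]) (auto simp: Hom_iff)
    ultimately show ?thesis
      using normalized_point_cancel[OF alg'(2) t'(2) hom] hom by metis
  qed
  then show "pointed_algebra_morphism C A B f \<longleftrightarrow>
      pointed_braided_morphism C (sigma_Lei_obj C A) (sigma_Lei_obj C B) f"
    by (auto simp: eq eq')
qed

end

theorem proposition5p11:
  fixes C :: "('o, 'm, 'z) monoidal_scheme"
    and D :: "('p, 'n, 'y) preadditive_symmetric_monoidal_scheme"
  shows "(strict_monoidal_category C \<longrightarrow>
      full_subcategory_via (UAlg C) (Br_nu C) (sigma_Ass_obj C) (same_arrow (sigma_Ass_obj C))) \<and>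
    (symmetric_preadditive_strict_monoidal_category D \<longrightarrow>
      full_subcategory_via (ULei_star D) (Br_nu D) (sigma_Lei_obj D) (same_arrow (sigma_Lei_obj D)))"
  by (blast intro: strict_monoidal_category.full_subcategory_via_sigma_Ass
      symmetric_preadditive_strict_monoidal_category.full_subcategory_via_sigma_Lei)

end
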